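(* The unique pair $(x,y)$ of positive integers satisfying the Diophantine equation $$2x^{3}-y^{3}=1$$ is $(x,y)=(1,1)$. *)

theory Defs
  imports Main
begin

end

theory Submission
  imports Defs "HOL-Computational_Algebra.Nth_Powers" "HOL-Library.Discrete_Functions"
    "HOL-Number_Theory.Cong"
begin

text \<open>
  The equation says \<open>y\<^sup>3 + 1\<^sup>3 = 2 x\<^sup>3\<close>, an instance of \<open>x\<^sup>3 + y\<^sup>3 = 2 z\<^sup>3\<close> with \<open>x\<close> and \<open>y\<close> coprime,
  for which Euler's descent gives \<open>x = \<plusminus>y\<close>. With \<open>x = p + q\<close> and \<open>y = p - q\<close> it becomes
  \<open>p (p\<^sup>2 + 3 q\<^sup>2) = z\<^sup>3\<close>. If \<open>3\<close> does not divide \<open>p\<close>, both factors are cubes, and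
  \<open>p\<^sup>2 + 3 q\<^sup>2 = u\<^sup>3\<close> forces \<open>p + q \<surd>-3 = (a + b \<surd>-3)\<^sup>3\<close>; if \<open>p = 3 r\<close>, the same holds for
  \<open>9 r\<close> and \<open>q\<^sup>2 + 3 r\<^sup>2\<close>. In both cases \<open>p\<close> is, up to a factor 9, a product of three coprime
  cubes, twice one of which is the sum or difference of the other two: a smaller solution.

  Unique factorization is not used for the cube root: with \<open>p \<equiv> t q\<close> modulo \<open>u\<^sup>3\<close>, Thue's lemma
  yields \<open>a\<^sup>2 + 3 b\<^sup>2 = u\<close> with \<open>a \<equiv> t b\<close> modulo \<open>u\<close>, and \<open>a + b \<surd>-3\<close> can be divided out of
  \<open>p + q \<surd>-3\<close> three times.
\<close>

section \<open>Coprime factors of a cube\<close>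

text \<open>Signs do no harm because -1 is a cube, so the case of nonzero factors reduces to the
  natural numbers. If \<open>b = 0\<close>, coprimality makes \<open>a\<close> a unit.\<close>

lemma cube_factor_coprime_int:
  fixes a b c :: int
  assumes "coprime a b" "a * b = c ^ 3"
  shows "\<exists>d. a = d ^ 3"
proof (cases "a = 0 \<or> b = 0")
  case True
  then show ?thesis
  proof
    assume "a = 0"
    then have "a = 0 ^ 3" by simp
    then show ?thesis ..
  next
    assume "b = 0"
    then have "\<bar>a\<bar> = 1" using assms by simp
    then have "a = 1 ^ 3 \<or> a = (-1) ^ 3" by auto
    then show ?thesis by blast
  qed
next
  case False
  have "coprime (nat \<bar>a\<bar>) (nat \<bar>b\<bar>)"
    using assms(1) by (simp add: coprime_nat_abs_left_iff)
  moreover have "nat \<bar>a\<bar> * nat \<bar>b\<bar> = nat \<bar>c\<bar> ^ 3"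
    using assms(2) by (simp flip: nat_mult_distrib nat_power_eq abs_mult power_abs)
  then have "is_nth_power 3 (nat \<bar>a\<bar> * nat \<bar>b\<bar>)" by (rule is_nth_powerI)
  ultimately have "is_nth_power 3 (nat \<bar>a\<bar>)"
    by (rule is_nth_power_mult_coprime_natD(1)) (use False in simp_all)
  then obtain d where "nat \<bar>a\<bar> = d ^ 3" by (rule is_nth_powerE)
  then have "\<bar>a\<bar> = int d ^ 3" by (metis abs_ge_zero nat_0_le of_nat_power)
  then have "a = int d ^ 3 \<or> a = (- int d) ^ 3" by (auto simp: abs_if split: if_splits)
  then show ?thesis by blast
qed

lemma cube_factors_pairwise_coprime_int:
  fixes a b c d :: int
  assumes "coprime a b" "coprime a c" "coprime b c" "a * b * c = d ^ 3"
  shows "\<exists>x y z. a = x ^ 3 \<and> b = y ^ 3 \<and> c = z ^ 3"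
proof -
  have "\<exists>x. a = x ^ 3"
    using assms by (intro cube_factor_coprime_int[of a "b * c" d]) (auto simp: mult_ac)
  moreover have "\<exists>x. b = x ^ 3"
    using assms by (intro cube_factor_coprime_int[of b "a * c" d]) (auto simp: mult_ac coprime_commute)
  moreover have "\<exists>x. c = x ^ 3"
    using assms by (intro cube_factor_coprime_int[of c "a * b" d]) (auto simp: mult_ac coprime_commute)
  ultimately show ?thesis by blast
qed

section \<open>Arithmetic of the form a^2 + 3 b^2\<close>

text \<open>Pigeonhole: with m the integer square root of \<open>u\<close>, there are (m + 1)^2 > u
  pairs with coordinates in [0, m], so two of them agree in x - t y modulo \<open>u\<close>; their
  difference has coordinates of size at most m.\<close>

lemma thue_int:
  fixes t u :: int
  assumes "u > 0"
  obtains a b where "a \<noteq> 0 \<or> b \<noteq> 0" "a\<^sup>2 \<le> u" "b\<^sup>2 \<le> u" "u dvd a - t * b"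
proof -
  define m where "m = int (floor_sqrt (nat u))"
  have "m \<ge> 0" by (simp add: m_def)
  have "int ((floor_sqrt (nat u))\<^sup>2) \<le> u"
    using floor_sqrt_power2_le[of "nat u"] assms by linarith
  then have m1: "m\<^sup>2 \<le> u" by (simp add: m_def)
  have "u < int ((Suc (floor_sqrt (nat u)))\<^sup>2)"
    using Suc_floor_sqrt_power2_gt[of "nat u"] assms by linarith
  then have m2: "u < (m + 1)\<^sup>2" by (simp add: m_def add.commute)
  define A where "A = {0..m} \<times> {0..m}"
  define f where "f = (\<lambda>(x, y). (x - t * y) mod u)"
  have "f ` A \<subseteq> {0..<u}" using assms by (auto simp: f_def)
  then have "card (f ` A) \<le> nat u"
    using card_mono[of "{0..<u}" "f ` A"] by simp
  moreover have "card A = nat ((m + 1)\<^sup>2)"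
    using \<open>m \<ge> 0\<close> by (simp add: A_def card_cartesian_product power2_eq_square nat_mult_distrib)
  ultimately have "card (f ` A) < card A" using m2 assms by simp
  then have "\<not> inj_on f A" by (rule pigeonhole)
  then obtain x y x' y' where xy: "(x, y) \<in> A" "(x', y') \<in> A" "(x, y) \<noteq> (x', y')" "f (x, y) = f (x', y')"
    unfolding inj_on_def by auto
  have sq: "(v - w)\<^sup>2 \<le> u" if "v \<in> {0..m}" "w \<in> {0..m}" for v w
  proof -
    have "\<bar>v - w\<bar> \<le> m" using that by auto
    then have "(v - w)\<^sup>2 \<le> m\<^sup>2" using abs_le_square_iff[of "v - w" m] \<open>m \<ge> 0\<close> by simp
    with m1 show ?thesis by linarith
  qed
  have "u dvd (x - t * y) - (x' - t * y')"
    using xy(4) by (simp add: f_def mod_eq_dvd_iff)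
  then have "u dvd (x - x') - t * (y - y')" by (simp add: algebra_simps)
  moreover have "x - x' \<noteq> 0 \<or> y - y' \<noteq> 0" using xy(3) by auto
  ultimately show ?thesis
    using sq xy(1,2) that[of "x - x'" "y - y'"] by (auto simp: A_def)
qed

lemma dvd_of_dvd_power2_three:
  fixes a :: int
  assumes "3 dvd a\<^sup>2"
  shows "3 dvd a"
  using assms prime_dvd_power_int[of 3 a 2] by simp

text \<open>Modulo \<open>u\<close> the form is (a - t b)(a + t b), so Thue's lemma gives a^2 + 3
  b^2 = k u with 1 \<le> k \<le> 4. It remains to treat k = 2, 3, 4.\<close>

lemma norm_form_representation:
  fixes t u :: int
  assumes "u > 0" "odd u" "\<not> 3 dvd u" "u dvd t\<^sup>2 + 3"
  obtains a b where "a\<^sup>2 + 3 * b\<^sup>2 = u" "u dvd a - t * b"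
proof -
  obtain a b where ab: "a \<noteq> 0 \<or> b \<noteq> 0" "a\<^sup>2 \<le> u" "b\<^sup>2 \<le> u" "u dvd a - t * b"
    using thue_int[OF assms(1)] .
  have "a\<^sup>2 + 3 * b\<^sup>2 = (a - t * b) * (a + t * b) + (t\<^sup>2 + 3) * b\<^sup>2"
    by (simp add: algebra_simps power2_eq_square)
  moreover have "u dvd (a - t * b) * (a + t * b) + (t\<^sup>2 + 3) * b\<^sup>2"
    using ab(4) assms(4) by simp
  ultimately obtain k where k: "a\<^sup>2 + 3 * b\<^sup>2 = u * k" by (metis dvdE)
  have pos: "a\<^sup>2 + 3 * b\<^sup>2 > 0"
    using ab(1) by (metis add_nonneg_pos add_pos_nonneg mult_pos_pos zero_le_power2 zero_less_numeral
        zero_less_power2 mult_nonneg_nonneg zero_le_numeral)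
  have "k > 0" using pos k assms(1) by (simp add: zero_less_mult_iff)
  moreover have "u * k \<le> u * 4" using ab(2,3) k by linarith
  then have "k \<le> 4" using assms(1) by simp
  ultimately consider "k = 1" | "k = 2" | "k = 3" | "k = 4" by linarith
  then show ?thesis
  proof cases
    case 1
    then show ?thesis using k ab(4) that by simp
  next
    \<comment> \<open>\<open>a\<close> and \<open>b\<close> have equal parity, so the form is
      divisible by 4 and \<open>u\<close> would be even.\<close>
    case 2
    have "even (a\<^sup>2 + 3 * b\<^sup>2)" using k 2 by simp
    then have "even (a - b)" by simp
    then obtain c where "a = b + 2 * c" by (metis dvdE add.commute diff_add_cancel)
    then have "2 * u = 4 * (b\<^sup>2 + b * c + c\<^sup>2)"
      using k 2 by (simp add: algebra_simps power2_eq_square)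
    then have "even u" by presburger
    then show ?thesis using assms(2) by simp
  next
    \<comment> \<open>Here \<open>3 dvd a\<close>, and dividing a + b sqrt(-3) by sqrt(-3) gives b -
      c sqrt(-3), of norm \<open>u\<close>.\<close>
    case 3
    have "a\<^sup>2 = 3 * (u - b\<^sup>2)" using k 3 by (simp add: algebra_simps)
    then have "3 dvd a" by (simp add: dvd_of_dvd_power2_three)
    then obtain c where c: "a = 3 * c" ..
    have "b\<^sup>2 + 3 * (- c)\<^sup>2 = u" using k 3 c by (simp add: power2_eq_square)
    moreover have "u dvd b - t * (- c)"
    proof -
      have "3 * (b - t * (- c)) = t * (a - t * b) + (t\<^sup>2 + 3) * b"
        by (simp add: c algebra_simps power2_eq_square)
      then have "u dvd 3 * (b - t * (- c))" using ab(4) assms(4) by simp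
      moreover have "coprime u 3"
        using assms(3) prime_imp_coprime_int[of 3 u] by (simp add: coprime_commute)
      ultimately show ?thesis using coprime_dvd_mult_right_iff by blast
    qed
    ultimately show ?thesis by (rule that)
  next
    \<comment> \<open>Both Thue bounds are attained, so b = s a with a sign s. Then \<open>a\<close>
      divides 1 - t^2 and t^2 + 3, hence 4; being odd, it is a unit.\<close>
    case 4
    have aa: "a\<^sup>2 = u" and bb: "b\<^sup>2 = u" using ab(2,3) k 4 by auto
    then have "a\<^sup>2 = b\<^sup>2" by simp
    then have "b = a \<or> b = - a" by (auto simp: power2_eq_iff)
    then obtain s where s: "b = s * a" "s\<^sup>2 = 1"
      by (metis mult_1 mult_minus1 power_one power2_minus)
    have "a \<noteq> 0" using aa assms(1) by auto
    have "a * a dvd a * (1 - t * s)" using ab(4) aa s by (simp add: power2_eq_square algebra_simps)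
    then have "a dvd 1 - t * s" using \<open>a \<noteq> 0\<close> by simp
    then have "a dvd (1 - t * s) * (1 + t * s)" by simp
    also have "(1 - t * s) * (1 + t * s) = 1 - t\<^sup>2 * s\<^sup>2" by (simp add: algebra_simps power2_eq_square)
    finally have "a dvd 1 - t\<^sup>2" using s by simp
    moreover have "a dvd t\<^sup>2 + 3" using aa assms(4) by (metis dvd_trans dvd_triv_left power2_eq_square)
    ultimately have "a dvd (1 - t\<^sup>2) + (t\<^sup>2 + 3)" by (rule dvd_add)
    then have "a dvd 2 * 2" by simp
    moreover have "coprime a 2" using aa assms(2) by auto
    then have "coprime a (2 * 2)" by (simp only: coprime_mult_right_iff simp_thms)
    ultimately have "is_unit a" by (metis coprime_absorb_left)
    then have "u = 1" using aa by (auto simp: abs_eq_iff' split: if_splits)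
    then show ?thesis using that[of 1 0] by simp
  qed
qed

text \<open>Division of \<open>p + q \<surd>-3\<close> by \<open>a + b \<surd>-3\<close>. The congruences say that both elements vanish
  under \<open>\<surd>-3 \<mapsto> -t\<close>; this excludes the conjugate divisor \<open>a - b \<surd>-3\<close>.\<close>

lemma norm_form_divide:
  fixes a b p q t u w :: int
  assumes "u \<noteq> 0" "a\<^sup>2 + 3 * b\<^sup>2 = u" "u dvd a - t * b" "u * w dvd p - t * q" "u * w dvd t\<^sup>2 + 3"
  obtains p' q' where "p = a * p' - 3 * b * q'" "q = a * q' + b * p'" "w dvd p' - t * q'"
    "p\<^sup>2 + 3 * q\<^sup>2 = u * (p'\<^sup>2 + 3 * q'\<^sup>2)"
proof -
  have d: "u dvd p - t * q" "u dvd t\<^sup>2 + 3"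
    using assms(4,5) by (auto intro: dvd_mult_left)
  \<comment> \<open>\<open>a * p + 3 * b * q\<close> and \<open>a * q - b * p\<close> are the
    coordinates of (p + q sqrt(-3)) (a - b sqrt(-3)); dividing them by the norm \<open>u\<close>
    gives the quotient.\<close>
  have "a * p + 3 * b * q = a * (p - t * q) + q * (t * (a - t * b) + (t\<^sup>2 + 3) * b)"
    by (simp add: algebra_simps power2_eq_square)
  then have "u dvd a * p + 3 * b * q" using d assms(3) by simp
  then obtain p' where p': "a * p + 3 * b * q = u * p'" ..
  have "a * q - b * p = q * (a - t * b) - b * (p - t * q)"
    by (simp add: algebra_simps)
  then have "u dvd a * q - b * p" using d assms(3) by simp
  then obtain q' where q': "a * q - b * p = u * q'" ..
  have "u * p = a * (a * p + 3 * b * q) - 3 * b * (a * q - b * p)"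
    unfolding assms(2)[symmetric] by (simp add: algebra_simps power2_eq_square)
  also have "\<dots> = u * (a * p' - 3 * b * q')" unfolding p' q' by (simp add: algebra_simps)
  finally have 1: "p = a * p' - 3 * b * q'" using assms(1) by simp
  have "u * q = a * (a * q - b * p) + b * (a * p + 3 * b * q)"
    unfolding assms(2)[symmetric] by (simp add: algebra_simps power2_eq_square)
  also have "\<dots> = u * (a * q' + b * p')" unfolding p' q' by (simp add: algebra_simps)
  finally have 2: "q = a * q' + b * p'" using assms(1) by simp
  \<comment> \<open>The quotient keeps the congruence with \<open>w\<close> in place of
    \<open>u * w\<close>, so the division can be repeated.\<close>
  have "u * (p' - t * q') = (a * p + 3 * b * q) - t * (a * q - b * p)"
    unfolding p' q' by (simp add: algebra_simps)
  also have "\<dots> = a * (p - t * q) + b * (t * (p - t * q) + (t\<^sup>2 + 3) * q)"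
    by (simp add: algebra_simps power2_eq_square)
  finally have "u * w dvd u * (p' - t * q')" using assms(4,5) by simp
  then have 3: "w dvd p' - t * q'" using assms(1) by simp
  have "p\<^sup>2 + 3 * q\<^sup>2 = u * (p'\<^sup>2 + 3 * q'\<^sup>2)"
    unfolding 1 2 assms(2)[symmetric] by (simp add: algebra_simps power2_eq_square)
  with 1 2 3 show ?thesis by (rule that)
qed

text \<open>The conclusion lists the coordinates of (a + b sqrt(-3))^3. Three divisions by an
  element of norm \<open>u\<close> leave an element of norm 1, that is 1 or -1, which is its own
  cube.\<close>

lemma norm_form_eq_cube:
  fixes p q u :: int
  assumes eq: "p\<^sup>2 + 3 * q\<^sup>2 = u ^ 3" and cop: "coprime p q" and "odd u" "\<not> 3 dvd p"
  obtains a b where "p = a * (a\<^sup>2 - 9 * b\<^sup>2)" "q = 3 * b * (a\<^sup>2 - b\<^sup>2)"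
proof -
  have "p \<noteq> 0" using assms(4) by auto
  then have "u ^ 3 > 0" unfolding eq[symmetric] by (simp add: add_pos_nonneg)
  then have u: "u > 0" by (simp add: zero_less_power_eq)
  have "\<not> 3 dvd u"
  proof
    assume "3 dvd u"
    then have "3 dvd p\<^sup>2 + 3 * q\<^sup>2" unfolding eq by (simp add: power3_eq_cube)
    then have "3 dvd p\<^sup>2" by (simp add: dvd_add_left_iff)
    then show False using assms(4) dvd_of_dvd_power2_three by blast
  qed
  have "coprime (p\<^sup>2) q" using cop by simp
  then have "coprime (p\<^sup>2 + 3 * q\<^sup>2) q"
    by (metis coprime_iff_gcd_eq_1 gcd.commute gcd_add_mult mult.assoc mult.commute power2_eq_square add.commute)
  then have cu: "coprime q (u ^ 3)" unfolding eq by (simp add: coprime_commute)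
  \<comment> \<open>\<open>r\<close> inverts \<open>q\<close> modulo u^3, so \<open>t\<close> is p /
    q there and t^2 = -3.\<close>
  then obtain r where r: "[q * r = 1] (mod (u ^ 3))" using cong_solve_coprime_int by blast
  define t where "t = p * r"
  have ut: "u ^ 3 dvd p - t * q"
  proof -
    have "u ^ 3 dvd q * r - 1" using r by (simp add: cong_iff_dvd_diff)
    then have "u ^ 3 dvd (- p) * (q * r - 1)" by (rule dvd_mult)
    then show ?thesis by (simp add: t_def algebra_simps)
  qed
  have "q\<^sup>2 * (t\<^sup>2 + 3) = (p\<^sup>2 + 3 * q\<^sup>2) - (p - t * q) * (p + t * q)"
    by (simp add: algebra_simps power2_eq_square)
  then have "u ^ 3 dvd q\<^sup>2 * (t\<^sup>2 + 3)" using ut eq by simp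
  then have ut3: "u ^ 3 dvd t\<^sup>2 + 3"
    using cu by (simp add: coprime_dvd_mult_right_iff coprime_commute)
  have p1: "u * u\<^sup>2 dvd p - t * q" "u * u\<^sup>2 dvd t\<^sup>2 + 3"
    using ut ut3 by (simp_all add: power3_eq_cube power2_eq_square mult_ac)
  have p2: "u * u dvd t\<^sup>2 + 3" using p1(2) by (metis dvd_mult_right power2_eq_square)
  have p3: "u * 1 dvd t\<^sup>2 + 3" using p2 by (metis dvd_mult_right mult_1_right)
  have "u \<noteq> 0" using u by simp
  obtain a b where ab: "a\<^sup>2 + 3 * b\<^sup>2 = u" "u dvd a - t * b"
    using norm_form_representation[OF u \<open>odd u\<close> \<open>\<not> 3 dvd u\<close>] p3 by auto
  \<comment> \<open>Used three times, with \<open>w\<close> equal to u^2, \<open>u\<close> and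
    1.\<close>
  note div = norm_form_divide[OF \<open>u \<noteq> 0\<close> ab]
  obtain p' q' where 1: "p = a * p' - 3 * b * q'" "q = a * q' + b * p'" "u\<^sup>2 dvd p' - t * q'"
    "p\<^sup>2 + 3 * q\<^sup>2 = u * (p'\<^sup>2 + 3 * q'\<^sup>2)"
    using div[OF p1] .
  obtain p'' q'' where 2: "p' = a * p'' - 3 * b * q''" "q' = a * q'' + b * p''" "u dvd p'' - t * q''"
    "p'\<^sup>2 + 3 * q'\<^sup>2 = u * (p''\<^sup>2 + 3 * q''\<^sup>2)"
    using div[OF _ p2, of p' q'] 1(3) by (auto simp: power2_eq_square)
  obtain x y where 3: "p'' = a * x - 3 * b * y" "q'' = a * y + b * x"
    "p''\<^sup>2 + 3 * q''\<^sup>2 = u * (x\<^sup>2 + 3 * y\<^sup>2)"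
    using div[OF _ p3, of p'' q''] 2(3) by auto
  have "u ^ 3 * (x\<^sup>2 + 3 * y\<^sup>2) = u ^ 3 * 1"
    using eq 1(4) 2(4) 3(3) by (simp add: power3_eq_cube mult_ac)
  then have xy: "x\<^sup>2 + 3 * y\<^sup>2 = 1" using u by (subst (asm) mult_cancel_left) auto
  have y: "y = 0"
  proof (rule ccontr)
    assume "y \<noteq> 0"
    then have "y\<^sup>2 > 0" by simp
    then show False using xy zero_le_power2[of x] by linarith
  qed
  with xy have "x\<^sup>2 = 1" by simp
  \<comment> \<open>The remaining sign \<open>x\<close> satisfies x^3 = x, so it is absorbed into
    \<open>a\<close> and \<open>b\<close>.\<close>
  then have x: "x * (x * z) = z" "x ^ 3 = x" for z
    by (simp_all add: power2_eq_square power3_eq_cube flip: mult.assoc)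
  have "p = x * (a * (a\<^sup>2 - 9 * b\<^sup>2))" "q = x * (3 * b * (a\<^sup>2 - b\<^sup>2))"
    unfolding 1(1,2) 2(1,2) 3(1,2) y by (simp_all add: algebra_simps power2_eq_square)
  moreover have "(x * a) * ((x * a)\<^sup>2 - 9 * (x * b)\<^sup>2) = x * (a * (a\<^sup>2 - 9 * b\<^sup>2))"
    "3 * (x * b) * ((x * a)\<^sup>2 - (x * b)\<^sup>2) = x * (3 * b * (a\<^sup>2 - b\<^sup>2))"
    using \<open>x\<^sup>2 = 1\<close> by (simp_all add: power_mult_distrib)
  ultimately show ?thesis by (intro that[of "x * a" "x * b"]) (simp_all only:)
qed

section \<open>Descent for x^3 + y^3 = 2 z^3\<close>

lemma abs_less_of_cube_dvd:
  fixes c n p z :: int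
  assumes "c ^ 3 dvd p" "p \<noteq> 0" "n > 1" "z ^ 3 = p * n"
  shows "nat \<bar>c\<bar> < nat \<bar>z\<bar>"
proof -
  have "\<bar>c\<bar> ^ 3 \<le> \<bar>p\<bar>" using dvd_imp_le_int[OF assms(2,1)] by (simp add: power_abs)
  also have "\<dots> < \<bar>p\<bar> * n" using assms(2,3) by simp
  also have "\<dots> = \<bar>z\<bar> ^ 3" using assms(3,4) by (simp add: abs_mult flip: power_abs)
  finally show ?thesis using power_less_imp_less_base[of "\<bar>c\<bar>" 3 "\<bar>z\<bar>"] by simp
qed

text \<open>Strong induction on |z|. If p q = 0 the claim is immediate; otherwise the claim for the
  smaller solution forces a b = 0, hence p q = 0, a contradiction.\<close>

lemma sum_cubes_eq_twice_cube:
  fixes x y z :: int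
  assumes "coprime x y" "x ^ 3 + y ^ 3 = 2 * z ^ 3"
  shows "x = y \<or> x = - y"
  using assms
proof (induction "nat \<bar>z\<bar>" arbitrary: x y z rule: less_induct)
  case less
  have "even (x ^ 3 + y ^ 3)" unfolding less.prems(2) by simp
  then have "even (x + y)" by simp
  then obtain p where p: "x + y = 2 * p" ..
  define q where "q = p - y"
  have xy: "x = p + q" "y = p - q" using p by (simp_all add: q_def)
  have pq: "coprime p q"
  proof (rule coprimeI)
    fix d assume "d dvd p" "d dvd q"
    then have "d dvd x" "d dvd y" by (simp_all add: xy)
    then show "is_unit d" using less.prems(1) coprime_common_divisor by blast
  qed
  have odd: "odd (p + q)"
  proof
    assume "even (p + q)"
    then have "2 dvd x" "2 dvd y" by (simp_all add: xy)
    then show False using less.prems(1) coprime_common_divisor by fastforce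
  qed
  have zp: "z ^ 3 = p * (p\<^sup>2 + 3 * q\<^sup>2)"
    using less.prems(2) by (simp add: xy algebra_simps power2_eq_square power3_eq_cube)
  have prime3: "coprime n 3" if "\<not> 3 dvd n" for n :: int
    using prime_imp_coprime_int[of 3 n] that by (simp add: coprime_commute)
  show ?case
  proof (cases "p = 0 \<or> q = 0")
    case True
    then show ?thesis by (auto simp: xy)
  next
    case False
    then have nz: "p \<noteq> 0" "q \<noteq> 0" by auto
    then have sq: "p\<^sup>2 > 0" "q\<^sup>2 > 0" by simp_all
    show ?thesis
    proof (cases "3 dvd p")
      case False
      have cop: "coprime p (p\<^sup>2 + 3 * q\<^sup>2)"
      proof -
        have "coprime p (3 * q\<^sup>2)" using pq prime3[OF False] by simp
        then show ?thesis
          using gcd_add_mult[of p p "3 * q\<^sup>2"] by (simp add: coprime_iff_gcd_eq_1 power2_eq_square)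
      qed
      obtain u where u: "p\<^sup>2 + 3 * q\<^sup>2 = u ^ 3"
        using cube_factor_coprime_int[of "p\<^sup>2 + 3 * q\<^sup>2" p z] cop zp by (auto simp: mult.commute coprime_commute)
      obtain c where c: "p = c ^ 3"
        using cube_factor_coprime_int[of p "p\<^sup>2 + 3 * q\<^sup>2" z] cop zp by auto
      have "odd (p\<^sup>2 + 3 * q\<^sup>2)" using odd by simp
      then have "odd u" unfolding u by simp
      then obtain a b where ab: "p = a * (a\<^sup>2 - 9 * b\<^sup>2)" "q = 3 * b * (a\<^sup>2 - b\<^sup>2)"
        using norm_form_eq_cube[OF u pq _ False] by blast
      have "coprime a b"
      proof (rule coprimeI)
        fix d assume "d dvd a" "d dvd b"
        then have "d dvd p" "d dvd q" by (simp_all add: ab)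
        then show "is_unit d" using pq coprime_common_divisor by blast
      qed
      moreover have "\<not> 3 dvd a" using False ab by auto
      ultimately have a3b: "coprime a (3 * b)" using prime3 by simp
      \<comment> \<open>Parity removes the 2 from the common divisors of a - 3 b and a + 3 b, whose
        sum is 2 a.\<close>
      have odd_ab: "odd (a - 3 * b)" using odd unfolding ab by auto
      have c1: "coprime a (a - 3 * b)" "coprime a (a + 3 * b)"
        using a3b by (simp_all add: coprime_iff_gcd_eq_1)
           (metis gcd_add1 gcd.commute gcd_diff1 gcd_neg2 minus_diff_eq)+
      have c2: "coprime (a - 3 * b) (a + 3 * b)"
      proof (rule coprimeI)
        fix d assume d: "d dvd a - 3 * b" "d dvd a + 3 * b"
        then have "d dvd (a - 3 * b) + (a + 3 * b)" by (rule dvd_add)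
        then have "d dvd 2 * a" by (simp add: algebra_simps)
        moreover have "coprime (2 * a) (a - 3 * b)" using odd_ab c1 by simp
        ultimately show "is_unit d" using d(1) coprime_common_divisor by blast
      qed
      have "a * (a - 3 * b) * (a + 3 * b) = c ^ 3"
        unfolding c[symmetric] ab by (simp add: algebra_simps power2_eq_square)
      then obtain e f g where efg: "a = e ^ 3" "a - 3 * b = f ^ 3" "a + 3 * b = g ^ 3"
        using cube_factors_pairwise_coprime_int[OF c1 c2] by blast
      have "f ^ 3 + g ^ 3 = 2 * e ^ 3" unfolding efg[symmetric] by simp
      moreover have "coprime f g" using c2 unfolding efg(2,3) by simp
      moreover have "e ^ 3 dvd p" unfolding ab(1) efg(1)[symmetric] by simp
      then have "nat \<bar>e\<bar> < nat \<bar>z\<bar>"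
        using abs_less_of_cube_dvd[of e p "p\<^sup>2 + 3 * q\<^sup>2" z] nz zp sq by simp
      ultimately have "f = g \<or> f = - g" using less.hyps by blast
      then have "a - 3 * b = a + 3 * b \<or> a - 3 * b = - (a + 3 * b)" unfolding efg(2,3) by auto
      then have "b = 0 \<or> a = 0" by auto
      then show ?thesis using nz ab by auto
    next
      case True
      then obtain r where r: "p = 3 * r" ..
      have q3: "\<not> 3 dvd q"
      proof
        assume "3 dvd q"
        with True have "is_unit (3 :: int)" using pq coprime_common_divisor by blast
        then show False by simp
      qed
      have qr: "coprime q r" using pq r by (simp add: coprime_commute)
      \<comment> \<open>Since p^2 + 3 q^2 = 3 (q^2 + 3 r^2), the roles of the coordinates swap;
        \<open>9 * r\<close> collects all the explicit factors 3, and \<open>q3\<close> keeps the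
        two factors coprime.\<close>
      have zr: "z ^ 3 = 9 * r * (q\<^sup>2 + 3 * r\<^sup>2)"
        unfolding zp r by (simp add: algebra_simps power2_eq_square)
      have cop: "coprime (9 * r) (q\<^sup>2 + 3 * r\<^sup>2)"
      proof -
        have "coprime (3 * r) (q\<^sup>2)" using pq r by simp
        moreover have "q\<^sup>2 + 3 * r\<^sup>2 = r * (3 * r) + q\<^sup>2" by (simp add: power2_eq_square)
        ultimately have "coprime (3 * r) (q\<^sup>2 + 3 * r\<^sup>2)"
          by (metis coprime_iff_gcd_eq_1 gcd_add_mult)
        then have "coprime (3 * (3 * r)) (q\<^sup>2 + 3 * r\<^sup>2)"
          by (simp only: coprime_mult_left_iff simp_thms)
        then show ?thesis by simp
      qed
      obtain u where u: "q\<^sup>2 + 3 * r\<^sup>2 = u ^ 3"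
        using cube_factor_coprime_int[of "q\<^sup>2 + 3 * r\<^sup>2" "9 * r" z] cop zr
        by (auto simp: mult_ac coprime_commute)
      obtain c where c: "9 * r = c ^ 3"
        using cube_factor_coprime_int[of "9 * r" "q\<^sup>2 + 3 * r\<^sup>2" z] cop zr by auto
      have "odd (q\<^sup>2 + 3 * r\<^sup>2)" using odd r by simp
      then have "odd u" unfolding u by simp
      then obtain a b where ab: "q = a * (a\<^sup>2 - 9 * b\<^sup>2)" "r = 3 * b * (a\<^sup>2 - b\<^sup>2)"
        using norm_form_eq_cube[OF u qr _ q3] by blast
      have abc: "coprime a b"
      proof (rule coprimeI)
        fix d assume "d dvd a" "d dvd b"
        then have "d dvd q" "d dvd r" by (simp_all add: ab)
        then show "is_unit d" using qr coprime_common_divisor by blast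
      qed
      have odd_ab: "odd (a - b)" using odd unfolding r ab by auto
      have c1: "coprime b (a - b)" "coprime b (a + b)"
        using abc by (simp_all add: coprime_iff_gcd_eq_1)
           (metis gcd_add1 gcd_diff1 gcd.commute add.commute)+
      have c2: "coprime (a - b) (a + b)"
      proof (rule coprimeI)
        fix d assume d: "d dvd a - b" "d dvd a + b"
        then have "d dvd (a + b) - (a - b)" by (metis dvd_diff)
        then have "d dvd 2 * b" by (simp add: algebra_simps)
        moreover have "coprime (2 * b) (a - b)" using odd_ab c1 by simp
        ultimately show "is_unit d" using d(1) coprime_common_divisor by blast
      qed
      \<comment> \<open>The 9 joins the 3 in \<open>r\<close> to form the cube 27, which cancels
        against c^3.\<close>
      have c27: "c ^ 3 = 3 ^ 3 * (b * (a - b) * (a + b))"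
        unfolding c[symmetric] ab by (simp add: algebra_simps power2_eq_square)
      then have "3 ^ 3 dvd c ^ 3" by simp
      then have "3 dvd c" by (subst (asm) pow_divides_pow_iff) auto
      then obtain c' where "c = 3 * c'" ..
      then have "b * (a - b) * (a + b) = c' ^ 3" using c27 by (simp add: power_mult_distrib)
      then obtain e f g where efg: "b = e ^ 3" "a - b = f ^ 3" "a + b = g ^ 3"
        using cube_factors_pairwise_coprime_int[OF c1 c2] by blast
      \<comment> \<open>Here 2 b is the difference (a + b) - (a - b), so \<open>f\<close> enters
        with a minus sign.\<close>
      have "(- f) ^ 3 + g ^ 3 = 2 * e ^ 3" by (simp flip: efg)
      moreover have "coprime (- f) g" using c2 unfolding efg(2,3) by simp
      moreover have "e ^ 3 dvd p" unfolding r ab(2) efg(1)[symmetric] by simp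
      then have "nat \<bar>e\<bar> < nat \<bar>z\<bar>"
        using abs_less_of_cube_dvd[of e p "p\<^sup>2 + 3 * q\<^sup>2" z] nz zp sq by simp
      ultimately have "- f = g \<or> - f = - g" using less.hyps by blast
      then have "a - b = - (a + b) \<or> a - b = a + b" unfolding efg(2,3) by auto
      then have "a = 0 \<or> b = 0" by auto
      then show ?thesis using nz ab r by auto
    qed
  qed
qed

theorem theorem5:
  shows "{(x :: int, y :: int). x > 0 \<and> y > 0 \<and> 2 * x ^ 3 - y ^ 3 = 1} = {(1, 1)}"
proof -
  have "x = 1 \<and> y = 1" if "x > 0" "y > 0" "2 * x ^ 3 - y ^ 3 = 1" for x y :: int
  proof -
    \<comment> \<open>Positivity of \<open>y\<close> excludes the alternative y = -1.\<close>
    have "y = 1" using sum_cubes_eq_twice_cube[of y 1 x] that by simp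
    moreover from this have "x ^ 3 = 1 ^ 3" using that by simp
    then have "x = 1" using that(1) power_eq_imp_eq_base[of x 3 1] by simp
    ultimately show ?thesis by simp
  qed
  then show ?thesis by auto
qed

end
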